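(* Let $r\ge 1$ and $n\ge 1$ be integers, let $\zeta=\exp(2\pi i/r)$, and let the cyclic group $\mathbb{Z}/r\mathbb{Z}$ act freely on $\mathbb{C}^*$ by multiplication by $\zeta$. Let \[ F_{\mathbb{Z}/r\mathbb{Z}}(\mathbb{C}^*,n)=\{(x_1,\dots,x_n)\in(\mathbb{C}^* )^n \mid x_j\neq \zeta^k x_i \text{ for all } i\neq j,\ 1\le k\le r\} \] be the orbit configuration space. Then $\mathrm{TC}(F_{\mathbb{Z}/r\mathbb{Z}}(\mathbb{C}^*,n))=2n$.
   Context: For a path-connected space $Y$, $\mathrm{TC}(Y)$ denotes Farber's (unreduced) topological complexity: the smallest integer $m$ such that $Y\times Y$ admits a cover by $m$ open sets on each of which the path fibration $Y^{I}\to Y\times Y$, $\gamma\mapsto(\gamma(0),\gamma(1))$, admits a continuous section (so contractible spaces have $\mathrm{TC}=1$). *)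

theory Defs
  imports "HOL-Analysis.Analysis" "HOL-Library.Extended_Nat"
begin

text \<open>A continuous section of the path fibration over U \<subseteq> Y \<times> Y, written via the
exponential law as a continuous homotopy U \<times> [0,1] \<rightarrow> Y with prescribed endpoints.\<close>
definition motion_planner_on :: "'a::topological_space set \<Rightarrow> ('a \<times> 'a) set \<Rightarrow> bool" where
  "motion_planner_on Y U \<longleftrightarrow>
     (\<exists>H :: ('a \<times> 'a) \<times> real \<Rightarrow> 'a.
        continuous_on (U \<times> {0..1}) H \<and> H ` (U \<times> {0..1}) \<subseteq> Y \<and>
        (\<forall>p\<in>U. H (p, 0) = fst p \<and> H (p, 1) = snd p))"

definition has_mp_cover :: "'a::topological_space set \<Rightarrow> nat \<Rightarrow> bool" where
  "has_mp_cover Y m \<longleftrightarrow>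
     (\<exists>U :: nat \<Rightarrow> ('a \<times> 'a) set.
        (\<forall>i<m. openin (top_of_set (Y \<times> Y)) (U i) \<and> motion_planner_on Y (U i)) \<and>
        Y \<times> Y \<subseteq> (\<Union>i<m. U i))"

text \<open>Farber's unreduced topological complexity (\<infinity> if no finite cover exists).\<close>
definition TC :: "'a::topological_space set \<Rightarrow> enat" where
  "TC Y = Inf {enat m | m. has_mp_cover Y m}"

definition orbit_conf :: "nat \<Rightarrow> (complex ^ 'n) set" where
  "orbit_conf r =
     {x. (\<forall>i. x $ i \<noteq> 0) \<and>
         (\<forall>i j. i \<noteq> j \<longrightarrow> (\<forall>k\<in>{1..r}.
            x $ j \<noteq> (exp (2 * of_real pi * \<i> / of_nat r)) ^ k * x $ i))}"

end

theory Submission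
  imports Defs
begin

text \<open>
Lower bound. Over a set with a motion planner, \<open>f x / f y\<close> has a continuous logarithm for every
continuous \<open>f : Y \<rightarrow> \<complex> - {0}\<close>. Fix an index \<open>o\<close> and take for \<open>f\<close> the \<open>n\<close> coordinates and the
\<open>n - 1\<close> functions \<open>1 - (x\<^sub>o / x\<^sub>i)\<^sup>r\<close>. Let the \<open>x\<^sub>i\<close> rotate on distinct circles with \<open>x\<^sub>o\<close> innermost and
the \<open>y\<^sub>i\<close> on distinct circles with \<open>y\<^sub>o\<close> outermost and at rest: on this \<open>(2n - 1)\<close>-torus the quotients
\<open>f x / f y\<close> wind independently. A cover by \<open>2n - 1\<close> planner sets would therefore lift to a cover of a
large cube by \<open>2n - 1\<close> closed sets, the \<open>j\<close>-th of which does not connect the \<open>j\<close>-th pair of faces,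
against the Poincare-Miranda theorem.

Upper bound. Stratify \<open>Y\<close> by the number, between \<open>1\<close> and \<open>n\<close>, of distinct directions of the \<open>x\<^sub>i\<^sup>r\<close>. In the logarithmic coordinates of \<open>x\<^sub>i / x\<^sub>o\<close>, a stratum is a topological sum of convex
cells, parametrised by \<open>x\<^sub>o\<close>. Moving \<open>x\<^sub>o\<close> to \<open>y\<^sub>o\<close> along the shorter arc needs two strata, so adding
codimensions stratifies \<open>Y \<times> Y\<close> by \<open>2(n - 1) + 2 = 2n\<close> locally closed sets with motion planners, and
these extend to open sets because \<open>Y\<close> is open in \<open>\<complex>\<^sup>n\<close>.
\<close>

subsection \<open>Motion planners and the orbit configuration space\<close>

text \<open>Swapping the factors of \<open>U \<times> {0..1}\<close> turns a planner into a homotopy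
  from \<open>fst\<close> to \<open>snd\<close>, so planners can be concatenated by transitivity of
  homotopy.\<close>

lemma motion_planner_on_iff_homotopic:
  "motion_planner_on Y U \<longleftrightarrow> homotopic_with_canon (\<lambda>_. True) U Y fst snd"
proof
  assume "motion_planner_on Y U"
  then obtain H where H: "continuous_on (U \<times> {0..1::real}) H" "H ` (U \<times> {0..1}) \<subseteq> Y"
    "\<And>p. p \<in> U \<Longrightarrow> H (p, 0) = fst p \<and> H (p, 1) = snd p"
    unfolding motion_planner_on_def by blast
  have "continuous_on ({0..1} \<times> U) (\<lambda>z. H (snd z, fst z))"
    by (rule continuous_on_compose2[OF H(1)]) (auto intro!: continuous_intros)
  then show "homotopic_with_canon (\<lambda>_. True) U Y fst snd"
    using H(2,3) by (subst homotopic_with) (auto intro!: exI[of _ "\<lambda>z. H (snd z, fst z)"])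
next
  assume "homotopic_with_canon (\<lambda>_. True) U Y fst snd"
  then obtain h where h: "continuous_on ({0..1::real} \<times> U) h" "h \<in> ({0..1} \<times> U) \<rightarrow> Y"
    "\<And>p. h (0, p) = fst p" "\<And>p. h (1, p) = snd p"
    unfolding homotopic_with_def by auto
  have "continuous_on (U \<times> {0..1}) (\<lambda>z. h (snd z, fst z))"
    by (rule continuous_on_compose2[OF h(1)]) (auto intro!: continuous_intros)
  then show "motion_planner_on Y U"
    unfolding motion_planner_on_def
    using h(2) by (intro exI[of _ "\<lambda>z. h (snd z, fst z)"]) (auto simp: h(3,4))
qed

lemma homotopic_with_canonI:
  assumes "continuous_on ({0..1::real} \<times> S) h"
    and "\<And>t x. 0 \<le> t \<Longrightarrow> t \<le> 1 \<Longrightarrow> x \<in> S \<Longrightarrow> h (t, x) \<in> T"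
    and "\<And>x. x \<in> S \<Longrightarrow> h (0, x) = f x" "\<And>x. x \<in> S \<Longrightarrow> h (1, x) = g x"
  shows "homotopic_with_canon (\<lambda>_. True) S T f g"
  using assms by (subst homotopic_with; simp) (intro exI[of _ h]; auto)

text \<open>The powers of \<open>\<zeta>\<close> are all the \<open>r\<close>-th roots of unity, so
  the orbit of a nonzero number is determined by its \<open>r\<close>-th power.\<close>

lemma orbit_conf_iff_powers:
  fixes x :: "complex ^ 'n"
  assumes "r \<ge> 1"
  shows "x \<in> orbit_conf r \<longleftrightarrow>
    (\<forall>i. x $ i \<noteq> 0) \<and> (\<forall>i j. i \<noteq> j \<longrightarrow> (x $ i) ^ r \<noteq> (x $ j) ^ r)"
proof -
  define \<zeta> where "\<zeta> = exp (2 * of_real pi * \<i> / of_nat r)"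
  have \<zeta>_power: "\<zeta> ^ k = exp (2 * of_real pi * \<i> * of_nat k / of_nat r)" for k
    by (simp add: \<zeta>_def exp_of_nat_mult[symmetric] mult_ac)
  have roots: "{z. z ^ r = 1} = {\<zeta> ^ k | k. k < r}"
    using complex_roots_unity[OF assms] by (simp add: \<zeta>_power)
  have r1: "\<zeta> ^ r = 1"
    using assms by (simp add: \<zeta>_power exp_two_pi_i)
  have powers: "(\<exists>k\<in>{1..r}. b = \<zeta> ^ k * a) \<longleftrightarrow> a ^ r = b ^ r" if "a \<noteq> 0" for a b :: complex
  proof
    assume "\<exists>k\<in>{1..r}. b = \<zeta> ^ k * a"
    then show "a ^ r = b ^ r"
      by (metis mult_1 power_mult_distrib power_mult mult.commute power_one r1)
  next
    assume "a ^ r = b ^ r"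
    then have "(b / a) ^ r = 1"
      using that by (simp add: power_divide flip: \<open>a ^ r = b ^ r\<close>)
    then obtain k where k: "k < r" "b / a = \<zeta> ^ k"
      using roots by blast
    \<comment> \<open>Exponents run from 0 to \<open>r - 1\<close> in the list of roots but from 1
      to \<open>r\<close> in the definition; 0 becomes \<open>r\<close>.\<close>
    then have "b = \<zeta> ^ (if k = 0 then r else k) * a"
      using that r1 by (auto simp: field_simps)
    then show "\<exists>k\<in>{1..r}. b = \<zeta> ^ k * a"
      using k assms by (intro bexI[of _ "if k = 0 then r else k"]) auto
  qed
  have "x \<in> orbit_conf r \<longleftrightarrow> (\<forall>i. x $ i \<noteq> 0) \<and>
      (\<forall>i j. i \<noteq> j \<longrightarrow> \<not> (\<exists>k\<in>{1..r}. x $ j = \<zeta> ^ k * x $ i))"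
    unfolding orbit_conf_def \<zeta>_def by blast
  also have "\<dots> \<longleftrightarrow> (\<forall>i. x $ i \<noteq> 0) \<and> (\<forall>i j. i \<noteq> j \<longrightarrow> (x $ i) ^ r \<noteq> (x $ j) ^ r)"
    by (rule conj_cong[OF refl]) (simp only: powers simp_thms)
  finally show ?thesis .
qed

subsection \<open>The lower bound\<close>

text \<open>Brouwer's theorem is applied to \<open>x - \<phi> x\<close> clamped to the cube. At a
  fixed point a coordinate can be clamped only on a face, where the sign condition still forces
  \<open>\<phi> i x = 0\<close>.\<close>

lemma poincare_miranda:
  fixes \<phi> :: "'i::finite \<Rightarrow> real ^ 'i \<Rightarrow> real"
  assumes "L > 0"
    and cont: "\<And>i. continuous_on (cbox 0 (\<chi> i. L)) (\<phi> i)"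
    and lower: "\<And>i x. x \<in> cbox 0 (\<chi> i. L) \<Longrightarrow> x $ i = 0 \<Longrightarrow> \<phi> i x \<le> 0"
    and upper: "\<And>i x. x \<in> cbox 0 (\<chi> i. L) \<Longrightarrow> x $ i = L \<Longrightarrow> \<phi> i x \<ge> 0"
  obtains x where "x \<in> cbox 0 (\<chi> i. L)" "\<And>i. \<phi> i x = 0"
proof -
  let ?Q = "cbox 0 (\<chi> i. L) :: (real ^ 'i) set"
  define f where "f x = (\<chi> i. max 0 (min L (x $ i - \<phi> i x)))" for x
  have "continuous_on ?Q f"
    unfolding f_def by (intro continuous_intros cont)
  moreover have "f \<in> ?Q \<rightarrow> ?Q"
    using \<open>L > 0\<close> by (auto simp: f_def mem_box_cart)
  moreover have "0 \<in> ?Q"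
    using \<open>L > 0\<close> by (auto simp: mem_box_cart)
  ultimately obtain x where x: "x \<in> ?Q" "f x = x"
    using brouwer[of ?Q f] compact_cbox convex_box(1) by blast
  have "\<phi> i x = 0" for i
  proof -
    have "x $ i = max 0 (min L (x $ i - \<phi> i x))"
      using x(2) by (metis f_def vec_lambda_beta)
    then show ?thesis
      using lower[OF x(1), of i] upper[OF x(1), of i] \<open>L > 0\<close> by (smt (verit))
  qed
  with x(1) that show thesis by blast
qed

text \<open>A form of Lebesgue's covering theorem: the sign change of \<open>\<kappa> i\<close>, which is nowhere zero on
\<open>W i\<close>, says that no component of \<open>W i\<close> meets both of the \<open>i\<close>-th faces.\<close>

lemma cube_not_covered:
  fixes \<kappa> :: "'i::finite \<Rightarrow> real ^ 'i \<Rightarrow> real"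
  assumes "L > 0"
    and closed: "\<And>i. closed (W i)"
    and cont: "\<And>i. continuous_on (W i) (\<kappa> i)"
    and nz: "\<And>i x. x \<in> W i \<Longrightarrow> \<kappa> i x \<noteq> 0"
    and lower: "\<And>i x. x \<in> W i \<Longrightarrow> x $ i = 0 \<Longrightarrow> \<kappa> i x < 0"
    and upper: "\<And>i x. x \<in> W i \<Longrightarrow> x $ i = L \<Longrightarrow> \<kappa> i x > 0"
  shows "\<not> cbox 0 (\<chi> i. L) \<subseteq> (\<Union>i. W i)"
proof
  assume cover: "cbox 0 (\<chi> i. L) \<subseteq> (\<Union>i. W i)"
  have "\<exists>\<phi>. continuous_on UNIV \<phi> \<and> (\<forall>x\<in>W i. \<phi> x \<noteq> 0) \<and>
      (\<forall>x. x $ i = 0 \<longrightarrow> \<phi> x = -1) \<and> (\<forall>x. x $ i = L \<longrightarrow> \<phi> x = (1::real))" for i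
  proof -
    \<comment> \<open>\<open>\<kappa> i\<close> is continuous only on \<open>W i\<close>. Its two
      sign regions, each joined with the matching face, are disjoint closed sets, so a Urysohn
      function replaces it on the whole space.\<close>
    define S where "S = (W i \<inter> \<kappa> i -` {..0}) \<union> {x. x $ i = 0}"
    define T where "T = (W i \<inter> \<kappa> i -` {0..}) \<union> {x. x $ i = L}"
    have "closed S" "closed T"
      unfolding S_def T_def
      by (auto intro!: closed_Un closed_Collect_eq continuous_intros
          continuous_closed_preimage[OF cont closed])
    moreover have "S \<inter> T = {}"
      using nz[of _ i] lower[of _ i] upper[of _ i] \<open>L > 0\<close>
      by (fastforce simp: S_def T_def)
    ultimately obtain \<phi> :: "real ^ 'i \<Rightarrow> real" where "continuous_on UNIV \<phi>"
      "\<And>x. x \<in> S \<Longrightarrow> \<phi> x = -1" "\<And>x. x \<in> T \<Longrightarrow> \<phi> x = 1"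
      using Urysohn[of S T "-1" 1] by metis
    moreover have "W i \<subseteq> S \<union> T"
      by (auto simp: S_def T_def)
    moreover have "{x. x $ i = 0} \<subseteq> S" "{x. x $ i = L} \<subseteq> T"
      by (auto simp: S_def T_def)
    ultimately show ?thesis
      by (intro exI[of _ \<phi>]) fastforce
  qed
  then obtain \<phi> where \<phi>: "\<And>i. continuous_on UNIV (\<phi> i)" "\<And>i x. x \<in> W i \<Longrightarrow> \<phi> i x \<noteq> (0::real)"
      "\<And>i x. x $ i = 0 \<Longrightarrow> \<phi> i x = -1" "\<And>i x. x $ i = L \<Longrightarrow> \<phi> i x = 1"
    by metis
  obtain x where x: "x \<in> cbox 0 (\<chi> i. L)" "\<And>i. \<phi> i x = 0"
    by (rule poincare_miranda[OF \<open>L > 0\<close>, of \<phi>])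
      (simp_all add: \<phi>(3,4) continuous_on_subset[OF \<phi>(1)])
  then obtain i where "x \<in> W i"
    using cover by blast
  with \<phi>(2) x(2) show False by blast
qed

text \<open>With a Lebesgue number \<delta> of the cover, \<open>C j\<close> keeps the points of
  \<open>K\<close> whose \<delta>-ball lies in the \<open>j\<close>-th open set.\<close>

lemma compact_closed_shrinking:
  fixes K :: "'a::metric_space set"
  assumes "compact K" "K \<subseteq> X" "\<And>j. openin (top_of_set X) (U j)" "K \<subseteq> (\<Union>j. U j)"
  obtains C where "\<And>j. compact (C j)" "\<And>j. C j \<subseteq> U j" "K \<subseteq> (\<Union>j. C j)"
proof -
  obtain O' where O': "\<And>j. open (O' j)" "\<And>j. U j = X \<inter> O' j"
    using assms(3) unfolding openin_open by metis
  obtain \<delta> where \<delta>: "\<delta> > 0" "\<And>x. x \<in> K \<Longrightarrow> \<exists>G\<in>range O'. ball x \<delta> \<subseteq> G"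
    by (rule Heine_Borel_lemma[OF assms(1), of "range O'"]) (use assms(4) O' in auto)
  define C where "C j = K - (\<Union>y\<in>- O' j. ball y \<delta>)" for j
  have "compact (C j)" for j
    unfolding C_def by (intro compact_diff assms(1)) auto
  moreover have "C j \<subseteq> U j" for j
  proof
    fix x assume "x \<in> C j"
    then have "x \<in> K" "x \<notin> ball x \<delta> \<or> x \<in> O' j"
      unfolding C_def by blast+
    then show "x \<in> U j"
      using \<delta>(1) assms(2) O'(2) by auto
  qed
  moreover have "K \<subseteq> (\<Union>j. C j)"
  proof
    fix x assume "x \<in> K"
    then obtain j where "ball x \<delta> \<subseteq> O' j" using \<delta>(2) by blast
    then have "x \<in> C j" using \<open>x \<in> K\<close> by (auto simp: C_def dist_commute subset_iff)
    then show "x \<in> (\<Union>j. C j)" by blast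
  qed
  ultimately show thesis using that by blast
qed

text \<open>The bound on \<open>Im (h u)\<close> makes \<open>g j \<circ> P\<close> wind in direction \<open>j\<close> only.\<close>

lemma no_logarithmic_cover:
  fixes P :: "real ^ 'i::finite \<Rightarrow> 'a::real_normed_vector" and U :: "'i \<Rightarrow> 'a set"
  assumes P: "continuous_on UNIV P" "range P \<subseteq> K"
    and K: "compact K" "K \<subseteq> X" "K \<subseteq> (\<Union>j. U j)"
    and U: "\<And>j. openin (top_of_set X) (U j)"
    and log: "\<And>j. \<exists>lg. continuous_on (U j) lg \<and> (\<forall>q\<in>U j. g j q = exp (lg q))"
    and wind: "\<And>j. U j \<noteq> {} \<Longrightarrow> \<exists>h. continuous_on UNIV h \<and>
      (\<forall>u. \<bar>Im (h u)\<bar> \<le> 2 * pi \<and> g j (P u) = exp (\<i> * of_real (u $ j) + h u))"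
  shows False
proof -
  obtain C where C: "\<And>j. compact (C j)" "\<And>j. C j \<subseteq> U j" "K \<subseteq> (\<Union>j. C j)"
    using compact_closed_shrinking[OF K(1,2) U K(3)] by metis
  have "\<forall>j. \<exists>lg. continuous_on (U j) lg \<and> (\<forall>q\<in>U j. g j q = exp (lg q))"
    using log by blast
  then obtain lg where lg: "\<And>j. continuous_on (U j) (lg j)"
      "\<And>j q. q \<in> U j \<Longrightarrow> g j q = exp (lg j q)"
    by metis
  \<comment> \<open>The condition on \<open>U j\<close> moves inside, so that \<open>h j\<close> can
    be chosen for all \<open>j\<close>; a constant serves when \<open>U j\<close> is empty.\<close>
  have "\<forall>j. \<exists>h. continuous_on UNIV h \<and> (U j \<noteq> {} \<longrightarrow>
      (\<forall>u. \<bar>Im (h u)\<bar> \<le> 2 * pi \<and> g j (P u) = exp (\<i> * of_real (u $ j) + h u)))"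
    using wind continuous_on_const by blast
  then obtain h where h: "\<And>j. continuous_on UNIV (h j)"
      "\<And>j u. U j \<noteq> {} \<Longrightarrow> \<bar>Im (h j u)\<bar> \<le> 2 * pi"
      "\<And>j u. U j \<noteq> {} \<Longrightarrow> g j (P u) = exp (\<i> * of_real (u $ j) + h j u)"
    by metis
  have "bounded (\<Union>j. lg j ` C j)"
    by (intro bounded_UN finite_class.finite_UNIV ballI compact_imp_bounded
        compact_continuous_image C continuous_on_subset[OF lg(1) C(2)])
  then obtain B where B: "\<And>j q. q \<in> C j \<Longrightarrow> norm (lg j q) \<le> B"
    unfolding bounded_iff by fast
  obtain N :: nat where N: "(2 * pi + B) / (2 * pi) \<le> N"
    using real_arch_simple by blast
  then have N': "2 * pi + B \<le> 2 * pi * N"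
    by (simp add: field_simps)
  define L where "L = 2 * pi * (2 * N + 1)"
  define W where "W j = P -` C j" for j
  \<comment> \<open>On \<open>W j\<close> the first three terms add up to an integral multiple of 2
    pi, because two exponentials agree. The threshold \<open>L / 2\<close> is a half-odd multiple,
    so the difference never vanishes; by the choice of \<open>N\<close> it exceeds the bounds on
    \<open>h\<close> and \<open>lg\<close>, which gives the signs on the faces.\<close>
  define \<kappa> where "\<kappa> j u = u $ j + Im (h j u) - Im (lg j (P u)) - 2 * pi * (N + 1 / 2)" for j u
  have WU: "P u \<in> U j" "P u \<in> C j" "U j \<noteq> {}" if "u \<in> W j" for u j
    using that C(2) by (auto simp: W_def)
  have contP: "continuous_on S P" for S
    using P(1) continuous_on_subset by blast
  have "\<not> cbox 0 (\<chi> i. L) \<subseteq> (\<Union>j. W j)"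
  proof (rule cube_not_covered[of L W \<kappa>])
    show "L > 0"
      by (simp add: L_def add_nonneg_pos)
    show "closed (W j)" for j
      unfolding W_def using continuous_closed_vimage[of "C j" P] C(1) P(1)
      by (simp add: compact_imp_closed continuous_on_eq_continuous_at)
    show "continuous_on (W j) (\<kappa> j)" for j
      unfolding \<kappa>_def
      by (intro continuous_intros continuous_on_subset[OF h(1)]
          continuous_on_compose2[OF lg(1) contP]) (auto dest: WU)
    show "\<kappa> j u \<noteq> 0" if u: "u \<in> W j" for j u
    proof
      assume 0: "\<kappa> j u = 0"
      have "exp (\<i> * of_real (u $ j) + h j u) = exp (lg j (P u))"
        using h(3)[of j u] lg(2)[of "P u" j] WU[OF u] by simp
      then obtain n :: int where
        "\<i> * of_real (u $ j) + h j u = lg j (P u) + of_real (of_int (2 * n) * pi) * \<i>"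
        unfolding exp_eq by blast
      from arg_cong[OF this, of Im]
      have "u $ j + Im (h j u) - Im (lg j (P u)) = 2 * pi * n"
        by simp
      with 0 have "2 * pi * n = 2 * pi * (N + 1 / 2)"
        by (simp add: \<kappa>_def)
      then have "real_of_int n = N + 1 / 2"
        by (metis mult_cancel_left pi_neq_zero mult_eq_0_iff zero_neq_numeral)
      then have "real_of_int (2 * n) = real_of_int (2 * int N + 1)"
        by simp
      then have "2 * n = 2 * int N + 1"
        unfolding of_int_eq_iff .
      then show False by presburger
    qed
    show "\<kappa> j u < 0" if u: "u \<in> W j" and "u $ j = 0" for j u
      using that h(2)[OF WU(3)[OF u], of u] abs_Im_le_cmod[of "lg j (P u)"] B[OF WU(2)[OF u]] N'
      unfolding \<kappa>_def by (simp add: algebra_simps) (use pi_gt_zero in linarith)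
    show "\<kappa> j u > 0" if u: "u \<in> W j" and "u $ j = L" for j u
      using that h(2)[OF WU(3)[OF u], of u] abs_Im_le_cmod[of "lg j (P u)"] B[OF WU(2)[OF u]] N'
      unfolding \<kappa>_def L_def by (simp add: algebra_simps) (use pi_gt_zero in linarith)
  qed
  moreover have "P u \<in> (\<Union>j. C j)" for u
    using P(2) C(3) by blast
  ultimately show False
    by (auto simp: W_def)
qed

text \<open>A motion planner deforms \<open>f x / f y\<close> to the constant \<open>1\<close> through \<open>f (H t) / f y\<close>.\<close>

lemma motion_planner_on_quotient_log:
  fixes f :: "'a::real_normed_vector \<Rightarrow> complex"
  assumes mp: "motion_planner_on Y U" and U: "U \<subseteq> Y \<times> Y"
    and f: "continuous_on Y f" "\<And>x. x \<in> Y \<Longrightarrow> f x \<noteq> 0"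
  shows "\<exists>lg. continuous_on U lg \<and> (\<forall>q\<in>U. f (fst q) / f (snd q) = exp (lg q))"
proof -
  obtain H where H: "continuous_on (U \<times> {0..1::real}) H" "H ` (U \<times> {0..1}) \<subseteq> Y"
    "\<And>p. p \<in> U \<Longrightarrow> H (p, 0) = fst p \<and> H (p, 1) = snd p"
    using mp unfolding motion_planner_on_def by blast
  have snd: "q \<in> U \<Longrightarrow> snd q \<in> Y" for q using U by auto
  have "homotopic_with_canon (\<lambda>_. True) U (-{0}) (\<lambda>q. f (fst q) / f (snd q)) (\<lambda>q. 1)"
  proof (rule homotopic_with_canonI[where h = "\<lambda>z. f (H (snd z, fst z)) / f (snd (snd z))"])
    show "continuous_on ({0..1} \<times> U) (\<lambda>z. f (H (snd z, fst z)) / f (snd (snd z)))"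
      by (intro continuous_intros continuous_on_compose2[OF f(1)] continuous_on_compose2[OF H(1)])
        (use H(2) snd f(2) in \<open>auto simp: image_subset_iff\<close>)
    show "f (H (snd (t, x), fst (t, x))) / f (snd (snd (t, x))) \<in> - {0}"
      if "0 \<le> t" "t \<le> 1" "x \<in> U" for t x
      using that H(2) snd f(2) by (auto simp: image_subset_iff)
  qed (use H(3) snd f(2) in auto)
  then show ?thesis
    by (intro inessential_eq_continuous_logarithm[THEN iffD1] exI)
qed

section \<open>Test configurations for the lower bound\<close>

lemma compact_vec_norm_eq:
  fixes R :: "'n::finite \<Rightarrow> real"
  shows "compact {x :: complex ^ 'n. \<forall>i. norm (x $ i) = R i}"
  unfolding compact_eq_bounded_closed
proof
  show "bounded {x :: complex ^ 'n. \<forall>i. norm (x $ i) = R i}"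
  proof (rule boundedI)
    fix x :: "complex ^ 'n" assume "x \<in> {x. \<forall>i. norm (x $ i) = R i}"
    then show "norm x \<le> (\<Sum>i\<in>UNIV. R i)"
      using L2_set_le_sum[of UNIV "\<lambda>i. norm (x $ i)", OF norm_ge_zero] unfolding norm_vec_def by simp
  qed
  show "closed {x :: complex ^ 'n. \<forall>i. norm (x $ i) = R i}"
    by (intro closed_Collect_all closed_Collect_eq continuous_intros)
qed

text \<open>\<open>1 - z\<close> lies in the open right half-plane, so its logarithm contributes no
  winding.\<close>

lemma Ln_one_minus:
  assumes "norm z < 1"
  shows "exp (Ln (1 - z)) = 1 - z" "\<bar>Im (Ln (1 - z))\<bar> < pi / 2" "1 - z \<notin> \<real>\<^sub>\<le>\<^sub>0"
proof -
  have "Re z < 1"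
    using assms complex_Re_le_cmod[of z] by linarith
  then have "Re (1 - z) > 0"
    by simp
  moreover from this have "1 - z \<noteq> 0"
    by force
  ultimately show "exp (Ln (1 - z)) = 1 - z" "\<bar>Im (Ln (1 - z))\<bar> < pi / 2" "1 - z \<notin> \<real>\<^sub>\<le>\<^sub>0"
    using Re_Ln_pos_lt[of "1 - z"] by (auto simp: complex_nonpos_Reals_iff)
qed

lemma orbit_conf_mp_cover_lower_bound:
  assumes "r \<ge> 1" and cover: "has_mp_cover (orbit_conf r :: (complex ^ 'n) set) m"
  shows "2 * CARD('n) \<le> m"
proof (rule ccontr)
  assume "\<not> 2 * CARD('n) \<le> m"
  then have m: "m \<le> 2 * CARD('n) - 1" by simp
  let ?Y = "orbit_conf r :: (complex ^ 'n) set"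
  note Y_iff = orbit_conf_iff_powers[OF \<open>r \<ge> 1\<close>]
  obtain V where V: "\<And>i. i < m \<Longrightarrow> openin (top_of_set (?Y \<times> ?Y)) (V i)"
      "\<And>i. i < m \<Longrightarrow> motion_planner_on ?Y (V i)" "?Y \<times> ?Y \<subseteq> (\<Union>i<m. V i)"
    using cover unfolding has_mp_cover_def by blast
  obtain b :: "'n \<Rightarrow> nat" where b: "bij_betw b UNIV {0..<CARD('n)}"
    using ex_bij_betw_finite_nat[OF finite_class.finite_UNIV] by blast
  obtain i0 where i0: "b i0 = 0"
    using b unfolding bij_betw_def by (metis atLeastLessThan_iff imageE le0 zero_less_card_finite)
  \<comment> \<open>The radii are 1 to \<open>n\<close>, with 1 at \<open>i0\<close>. Their
    reciprocals in \<open>K2\<close> reverse the order, which makes \<open>i0\<close> outermost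
    there.\<close>
  define R where "R i = real (b i) + 1" for i
  have R0: "R i0 = 1"
    by (simp add: R_def i0)
  have Rpos: "R i > 0" for i
    by (simp add: R_def add_nonneg_pos)
  have R_inj: "R i = R j \<longleftrightarrow> i = j" for i j
    using b by (auto simp: R_def bij_betw_def inj_on_def)
  have R1: "R i > 1" if "i \<noteq> i0" for i
    using R_inj[of i i0] that by (auto simp: R_def i0)
  define K1 where "K1 = {x :: complex ^ 'n. \<forall>i. norm (x $ i) = R i}"
  define K2 where "K2 = {x :: complex ^ 'n. \<forall>i. norm (x $ i) = 1 / R i}"
  have Y_of_norms: "x \<in> ?Y" if "\<And>i. x $ i \<noteq> 0" "\<And>i j. norm (x $ i) = norm (x $ j) \<Longrightarrow> i = j" for x
    unfolding Y_iff using that \<open>r \<ge> 1\<close>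
    by (metis norm_ge_zero norm_power power_eq_imp_eq_base less_le_trans zero_less_one)
  have K: "compact (K1 \<times> K2)" "K1 \<times> K2 \<subseteq> ?Y \<times> ?Y"
  proof -
    show "compact (K1 \<times> K2)"
      unfolding K1_def K2_def by (intro compact_Times compact_vec_norm_eq)
    have "x \<in> ?Y" if "x \<in> K1" for x
      using that Rpos R_inj by (intro Y_of_norms) (auto simp: K1_def, metis less_irrefl norm_zero)
    moreover have "x \<in> ?Y" if "x \<in> K2" for x
    proof (rule Y_of_norms)
      have x: "norm (x $ i) = 1 / R i" for i
        using that by (simp add: K2_def)
      show "x $ i \<noteq> 0" for i
        using x[of i] Rpos[of i] by auto
      show "i = j" if "norm (x $ i) = norm (x $ j)" for i j
        using that x[of i] x[of j] R_inj[of i j] by simp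
    qed
    ultimately show "K1 \<times> K2 \<subseteq> ?Y \<times> ?Y" by auto
  qed
  \<comment> \<open>Dividing by \<open>r\<close> lets the \<open>r\<close>-th power of the
    \<open>i\<close>-th coordinate of \<open>Z u\<close> turn with speed 1. \<open>X u\<close>
    carries the same phase, so it cancels in the quotient of coordinates.\<close>
  define \<psi> where "\<psi> u i = (if i = i0 then 0 else u $ Inr i / r)" for u :: "real ^ ('n + 'n)" and i
  define X where "X u = (\<chi> i. of_real (R i) * cis (u $ Inl i + \<psi> u i))" for u
  define Z where "Z u = (\<chi> i. of_real (1 / R i) * cis (\<psi> u i))" for u
  define f where "f j x = (case j of Inl i \<Rightarrow> x $ i | Inr i \<Rightarrow> 1 - (x $ i0 / x $ i) ^ r)"
    for j and x :: "complex ^ 'n"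
  obtain e where e: "bij_betw e (UNIV - {Inr i0 :: 'n + 'n}) {0..<2 * CARD('n) - 1}"
    using ex_bij_betw_finite_nat[of "UNIV - {Inr i0 :: 'n + 'n}"] by (auto simp: card_Diff_singleton mult_2)
  \<comment> \<open>The index type has \<open>2n\<close> elements, one more than needed:
    \<open>Inr i0\<close> gets the empty set and \<open>e\<close> numbers the others. Indices beyond
    the given cover get the empty set too.\<close>
  define U where "U j = (if j \<noteq> Inr i0 \<and> e j < m then V (e j) else {})" for j
  have U_open: "openin (top_of_set (?Y \<times> ?Y)) (U j)" for j
    using V(1) by (simp add: U_def)
  have f_cont: "continuous_on ?Y (f j)" and f_nz: "x \<in> ?Y \<Longrightarrow> f j x \<noteq> 0"
    if "j \<noteq> Inr i0" for j x
  proof -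
    show "continuous_on ?Y (f j)"
      by (cases j) (auto simp: f_def Y_iff intro!: continuous_intros)
    show "f j x \<noteq> 0" if "x \<in> ?Y"
      using that \<open>j \<noteq> Inr i0\<close> by (cases j) (auto simp: f_def Y_iff power_divide)
  qed
  show False
  proof (rule no_logarithmic_cover[of "\<lambda>u. (X u, Z u)" "K1 \<times> K2" "?Y \<times> ?Y" U
        "\<lambda>j q. f j (fst q) / f j (snd q)"])
    have cis_cont: "continuous_on UNIV (\<lambda>u. cis (g u))" if "continuous_on UNIV g"
      for g :: "real ^ ('n + 'n) \<Rightarrow> real"
      unfolding cis_conv_exp by (intro continuous_intros that)
    have \<psi>_cont: "continuous_on UNIV (\<lambda>u. \<psi> u i)" for i
      using \<open>r \<ge> 1\<close> by (cases "i = i0") (auto simp: \<psi>_def intro!: continuous_intros)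
    show "continuous_on UNIV (\<lambda>u. (X u, Z u))"
      unfolding X_def Z_def by (intro continuous_intros cis_cont \<psi>_cont)
    show "range (\<lambda>u. (X u, Z u)) \<subseteq> K1 \<times> K2"
      using Rpos by (auto simp: X_def Z_def K1_def K2_def norm_mult norm_divide less_imp_le)
    show "K1 \<times> K2 \<subseteq> (\<Union>j. U j)"
    proof
      fix q assume "q \<in> K1 \<times> K2"
      then obtain k where k: "k < m" "q \<in> V k"
        using K(2) V(3) by blast
      then have "k \<in> e ` (UNIV - {Inr i0})"
        using e m unfolding bij_betw_def by auto
      then obtain j where "j \<noteq> Inr i0" "e j = k" by auto
      then show "q \<in> (\<Union>j. U j)"
        using k by (auto simp: U_def intro!: exI[of _ j])
    qed
    show "\<exists>lg. continuous_on (U j) lg \<and> (\<forall>q\<in>U j. f j (fst q) / f j (snd q) = exp (lg q))" for j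
    proof (cases "U j = {}")
      case False
      then have "j \<noteq> Inr i0" "motion_planner_on ?Y (U j)"
        using V(2) by (auto simp: U_def split: if_splits)
      then show ?thesis
        using motion_planner_on_quotient_log[OF _ openin_imp_subset[OF U_open] f_cont f_nz]
        by blast
    qed auto
    fix j assume "U j \<noteq> {}"
    then have j: "j \<noteq> Inr i0" by (auto simp: U_def)
    show "\<exists>h. continuous_on UNIV h \<and> (\<forall>u. \<bar>Im (h u)\<bar> \<le> 2 * pi \<and>
        f j (fst (X u, Z u)) / f j (snd (X u, Z u)) = exp (\<i> * of_real (u $ j) + h u))"
    proof (cases j)
      case (Inl i)
      have "f j (X u) / f j (Z u) = exp (\<i> * of_real (u $ j) + of_real (2 * ln (R i)))" for u
      proof -
        have "f j (X u) / f j (Z u) = of_real (R i) * of_real (R i) * (cis (u $ j + \<psi> u i) / cis (\<psi> u i))"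
          using Rpos[of i] by (simp add: f_def X_def Z_def Inl)
        also have "cis (u $ j + \<psi> u i) / cis (\<psi> u i) = exp (\<i> * of_real (u $ j))"
          by (simp add: cis_conv_exp distrib_left exp_add)
        also have "complex_of_real (R i) * of_real (R i) = exp (of_real (2 * ln (R i)))"
          using Rpos[of i] by (simp add: exp_double exp_of_real power2_eq_square)
        finally show ?thesis
          by (simp add: exp_add mult.commute)
      qed
      then show ?thesis
        by (intro exI[of _ "\<lambda>u. of_real (2 * ln (R i))"]) auto
    next
      case (Inr i)
      with j have i: "i \<noteq> i0" by auto
      define p where "p u = (X u $ i0 / X u $ i) ^ r" for u
      define s where "s u = of_real (1 / R i ^ r) * cis (u $ Inr i)" for u :: "real ^ ('n + 'n)"
      have R_pow: "R i ^ r > 1"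
        using R1[OF i] \<open>r \<ge> 1\<close> by (simp add: one_less_power)
      have p_lt: "norm (p u) < 1" for u
        using R_pow Rpos[of i] by (simp add: p_def X_def norm_mult norm_divide norm_power R0 power_divide)
      have s_lt: "norm (s u) < 1" for u
        using R_pow Rpos[of i] by (simp add: s_def norm_mult norm_divide norm_power)
      have s_nz: "s u \<noteq> 0" for u
        using Rpos[of i] by (simp add: s_def)
      have fX: "f j (X u) = 1 - p u" for u
        by (simp add: f_def p_def Inr)
      have fZ: "f j (Z u) = - (1 - s u) / s u" for u
      proof -
        have "(Z u $ i) ^ r = s u"
          using i \<open>r \<ge> 1\<close> by (simp add: Z_def \<psi>_def s_def power_mult_distrib power_divide Complex.DeMoivre)
        moreover have "Z u $ i0 = 1"
          by (simp add: Z_def \<psi>_def R0)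
        ultimately have "(Z u $ i0 / Z u $ i) ^ r = 1 / s u"
          by (simp add: power_divide)
        then show ?thesis
          using s_nz[of u] by (simp add: f_def Inr field_simps)
      qed
      \<comment> \<open>Since \<open>i0\<close> is innermost in \<open>X u\<close>, the numerator
        \<open>1 - p u\<close> does not wind; since it is outermost in \<open>Z u\<close>, the
        denominator \<open>1 - 1 / s u\<close> winds like \<open>1 / s u\<close>. The quotient winds
        like \<open>s u\<close>. The sign gives pi and each logarithm less than pi / 2, at most 2 pi
        in all.\<close>
      define h where "h u = \<i> * of_real pi - of_real (ln (R i ^ r)) + Ln (1 - p u) - Ln (1 - s u)" for u
      have "f j (X u) / f j (Z u) = exp (\<i> * of_real (u $ j) + h u)" for u
      proof -
        have "s u = exp (- of_real (ln (R i ^ r))) * exp (\<i> * of_real (u $ Inr i))"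
          using Rpos[of i] by (simp add: s_def cis_conv_exp exp_minus exp_of_real divide_inverse
              del: of_real_power)
        then have "exp (\<i> * of_real (u $ j) + h u) =
            s u * exp (\<i> * of_real pi) * exp (Ln (1 - p u)) / exp (Ln (1 - s u))"
          unfolding h_def Inr by (simp add: exp_add exp_diff exp_minus divide_inverse mult_ac)
        also have "\<dots> = f j (X u) / f j (Z u)"
        proof -
          have "a * (-1) * b / c = b / (- c / a)" for a b c :: complex
            by simp
          then show ?thesis
            by (simp only: Ln_one_minus(1)[OF p_lt] Ln_one_minus(1)[OF s_lt] fX fZ exp_pi_i')
        qed
        finally show ?thesis by simp
      qed
      moreover have "\<bar>Im (h u)\<bar> \<le> 2 * pi" for u
        using Ln_one_minus(2)[OF p_lt, of u] Ln_one_minus(2)[OF s_lt, of u]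
        by (simp add: h_def)
      moreover have "continuous_on UNIV h"
      proof -
        have "continuous_on UNIV p"
          unfolding p_def X_def using Rpos
          by (auto intro!: continuous_intros cis_cont \<psi>_cont simp: less_imp_neq[THEN not_sym])
        moreover have "continuous_on UNIV s"
          unfolding s_def by (intro continuous_intros cis_cont)
        ultimately show ?thesis
          unfolding h_def by (intro continuous_intros) (auto simp: Ln_one_minus(3) p_lt s_lt)
      qed
      ultimately show ?thesis by auto
    qed
  qed (use K U_open in auto)
qed

subsection \<open>Covers from stratifications\<close>

lemma openin_Collect_eventually:
  assumes "\<And>x. x \<in> S \<Longrightarrow> Q x \<Longrightarrow> eventually Q (at x within S)"
  shows "openin (top_of_set S) {x \<in> S. Q x}"
proof (subst openin_subopen, safe)
  fix x assume x: "x \<in> S" "Q x"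
  then obtain T where "open T" "x \<in> T" "\<And>y. y \<in> T \<Longrightarrow> y \<noteq> x \<Longrightarrow> y \<in> S \<Longrightarrow> Q y"
    using assms unfolding eventually_at_topological by metis
  then show "\<exists>T. openin (top_of_set S) T \<and> x \<in> T \<and> T \<subseteq> {x \<in> S. Q x}"
    using x by (intro exI[of _ "S \<inter> T"]) (auto simp: openin_open_Int)
qed

text \<open>The endpoints prescribe the planner on \<open>W \<times> {0, 1}\<close>; Tietze extends it over \<open>W \<times> [0,1]\<close> with
values in the ambient space, and by compactness of \<open>[0,1]\<close> it stays in \<open>Y\<close> near \<open>A\<close>.\<close>

lemma motion_planner_on_extend_open:
  fixes Y :: "'a::euclidean_space set"
  assumes "open Y" and W: "openin (top_of_set (Y \<times> Y)) W" and A: "closedin (top_of_set W) A"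
    and mp: "motion_planner_on Y A"
  obtains U where "A \<subseteq> U" "openin (top_of_set (Y \<times> Y)) U" "motion_planner_on Y U"
proof -
  obtain h where h: "continuous_on ({0..1::real} \<times> A) h" "h \<in> ({0..1} \<times> A) \<rightarrow> Y"
    "\<And>p. h (0, p) = fst p" "\<And>p. h (1, p) = snd p"
    using mp unfolding motion_planner_on_iff_homotopic homotopic_with_def by auto
  define E where "E = {0..1::real} \<times> W"
  define S1 where "S1 = {0..1::real} \<times> A"
  define S2 where "S2 = {0::real} \<times> W"
  define S3 where "S3 = {1::real} \<times> W"
  let ?S = "S1 \<union> (S2 \<union> S3)"
  have AW: "A \<subseteq> W"
    using A closedin_imp_subset by blast
  have clo: "closedin (top_of_set E) S1" "closedin (top_of_set E) S2" "closedin (top_of_set E) S3"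
  proof -
    have "closedin (top_of_set {0..1}) {t}" if "t \<in> {0..1}" for t :: real
      using that by (intro closed_subset) auto
    then show "closedin (top_of_set E) S1" "closedin (top_of_set E) S2" "closedin (top_of_set E) S3"
      unfolding E_def S1_def S2_def S3_def by (auto intro!: closedin_Times A)
  qed
  then have cloS: "closedin (top_of_set E) ?S"
    by blast
  then have SE: "?S \<subseteq> E"
    using closedin_imp_subset by blast
  \<comment> \<open>Over \<open>A\<close> the given planner applies at all times; elsewhere only the
    endpoints are prescribed. On overlaps the prescriptions agree.\<close>
  define F where "F z = (if snd z \<in> A then h z else if fst z = 0 then fst (snd z) else snd (snd z))"
    for z :: "real \<times> 'a \<times> 'a"
  have "continuous_on S1 F"
    by (rule continuous_on_eq[OF h(1)[folded S1_def]]) (auto simp: F_def S1_def)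
  moreover have "continuous_on S2 F"
    by (rule continuous_on_eq[of S2 "\<lambda>z. fst (snd z)"])
      (auto simp: F_def S2_def h(3) intro!: continuous_intros)
  moreover have "continuous_on S3 F"
    by (rule continuous_on_eq[of S3 "\<lambda>z. snd (snd z)"])
      (auto simp: F_def S3_def h(4) intro!: continuous_intros)
  ultimately have "continuous_on ?S F"
    by (intro continuous_on_Un_local closedin_subset_trans[OF clo(1)]
        closedin_subset_trans[OF clo(2)] closedin_subset_trans[OF clo(3)]
        closedin_subset_trans[OF closedin_Un[OF clo(2,3)]])
      (use SE in auto)
  then obtain g where g: "continuous_on E g" "\<And>z. z \<in> ?S \<Longrightarrow> g z = F z"
    using Tietze_unbounded cloS by blast
  \<comment> \<open>These are the pairs whose extended path leaves \<open>Y\<close>; projection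
    along the compact interval is a closed map, so they form a closed set.\<close>
  define B where "B = {p. \<exists>t. t \<in> {0..1} \<and> (t, p) \<in> E \<inter> g -` (- Y)}"
  have "closedin (top_of_set W) B"
    unfolding B_def
    by (rule closedin_compact_projection)
      (use continuous_closedin_preimage[OF g(1), of "- Y"] \<open>open Y\<close> in \<open>auto simp: E_def\<close>)
  then have "openin (top_of_set W) (W - B)"
    by (simp add: closedin_def)
  then have "openin (top_of_set (Y \<times> Y)) (W - B)"
    using W openin_trans by blast
  moreover have "A \<subseteq> W - B"
  proof -
    have "g (t, p) \<in> Y" if "p \<in> A" "t \<in> {0..1}" for t p
      using that g(2)[of "(t, p)"] h(2) by (auto simp: S1_def F_def)
    then show ?thesis
      using AW by (auto simp: B_def)
  qed
  moreover have "motion_planner_on Y (W - B)"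
    unfolding motion_planner_on_iff_homotopic
  proof (rule homotopic_with_canonI[where h = g])
    show "continuous_on ({0..1} \<times> (W - B)) g"
      by (rule continuous_on_subset[OF g(1)]) (auto simp: E_def)
    show "g (0, p) = fst p" "g (1, p) = snd p" if "p \<in> W - B" for p
      using that g(2)[of "(0, p)"] g(2)[of "(1, p)"] h(3,4) by (auto simp: S2_def S3_def F_def)
  qed (auto simp: B_def E_def)
  ultimately show thesis
    using that by blast
qed

text \<open>Semicontinuity makes \<open>{k \<le> s}\<close> open and the stratum
  \<open>{s = k}\<close> closed in it, so the planner on each stratum extends to an open
  set.\<close>

lemma has_mp_cover_stratified:
  fixes Y :: "'a::euclidean_space set" and s :: "'a \<times> 'a \<Rightarrow> nat"
  assumes "open Y" and bound: "\<And>q. q \<in> Y \<times> Y \<Longrightarrow> s q < m"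
    and lsc: "\<And>q. q \<in> Y \<times> Y \<Longrightarrow> \<forall>\<^sub>F p in at q within Y \<times> Y. s q \<le> s p"
    and mp: "\<And>k. motion_planner_on Y {q \<in> Y \<times> Y. s q = k}"
  shows "has_mp_cover Y m"
proof -
  have op: "openin (top_of_set (Y \<times> Y)) {q \<in> Y \<times> Y. k \<le> s q}" for k
  proof (rule openin_Collect_eventually)
    fix q assume "q \<in> Y \<times> Y" "k \<le> s q"
    then show "\<forall>\<^sub>F p in at q within Y \<times> Y. k \<le> s p"
      using eventually_mono[OF lsc[of q], of "\<lambda>p. k \<le> s p"] by simp
  qed
  have "\<forall>k. \<exists>U. {q \<in> Y \<times> Y. s q = k} \<subseteq> U \<and> openin (top_of_set (Y \<times> Y)) U \<and> motion_planner_on Y U"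
  proof
    fix k
    have "closedin (top_of_set {q \<in> Y \<times> Y. k \<le> s q})
        ({q \<in> Y \<times> Y. k \<le> s q} - {q \<in> Y \<times> Y. Suc k \<le> s q})"
      by (intro closedin_diff closedin_subtopology_refl[THEN iffD2] openin_subset_trans[OF op]) auto
    also have "{q \<in> Y \<times> Y. k \<le> s q} - {q \<in> Y \<times> Y. Suc k \<le> s q} = {q \<in> Y \<times> Y. s q = k}"
      by auto
    finally have clo: "closedin (top_of_set {q \<in> Y \<times> Y. k \<le> s q}) {q \<in> Y \<times> Y. s q = k}" .
    show "\<exists>U. {q \<in> Y \<times> Y. s q = k} \<subseteq> U \<and> openin (top_of_set (Y \<times> Y)) U \<and> motion_planner_on Y U"
      by (rule motion_planner_on_extend_open[OF \<open>open Y\<close> op clo mp]) blast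
  qed
  from choice[OF this] obtain U where U: "\<forall>k. {q \<in> Y \<times> Y. s q = k} \<subseteq> U k \<and>
      openin (top_of_set (Y \<times> Y)) (U k) \<and> motion_planner_on Y (U k)" ..
  have "Y \<times> Y \<subseteq> (\<Union>k<m. U k)"
  proof
    fix q assume "q \<in> Y \<times> Y"
    then have "s q < m" "q \<in> U (s q)"
      using bound U by auto
    then show "q \<in> (\<Union>k<m. U k)" by blast
  qed
  then show ?thesis
    unfolding has_mp_cover_def using U by (intro exI[of _ U]) simp
qed

text \<open>The fibres of \<open>c\<close> are disjoint and open in \<open>A\<close>, so their
  planners glue. This handles a stratum that is a topological sum of cells.\<close>

lemma motion_planner_on_locally_constant:
  assumes lc: "\<And>q. q \<in> A \<Longrightarrow> \<forall>\<^sub>F p in at q within A. c p = c q"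
    and mp: "\<And>q. q \<in> A \<Longrightarrow> motion_planner_on Y {p \<in> A. c p = c q}"
  shows "motion_planner_on Y A"
proof -
  have "\<forall>k\<in>c ` A. \<exists>H. continuous_on ({p \<in> A. c p = k} \<times> {0..1}) H \<and>
      H ` ({p \<in> A. c p = k} \<times> {0..1::real}) \<subseteq> Y \<and>
      (\<forall>p\<in>{p \<in> A. c p = k}. H (p, 0) = fst p \<and> H (p, 1) = snd p)"
    using mp unfolding motion_planner_on_def by blast
  from bchoice[OF this] obtain H where
    "\<forall>k\<in>c ` A. continuous_on ({p \<in> A. c p = k} \<times> {0..1}) (H k) \<and>
      H k ` ({p \<in> A. c p = k} \<times> {0..1::real}) \<subseteq> Y \<and>
      (\<forall>p\<in>{p \<in> A. c p = k}. H k (p, 0) = fst p \<and> H k (p, 1) = snd p)" ..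
  then have H: "\<And>k. k \<in> c ` A \<Longrightarrow> continuous_on ({p \<in> A. c p = k} \<times> {0..1::real}) (H k)"
    "\<And>k. k \<in> c ` A \<Longrightarrow> H k ` ({p \<in> A. c p = k} \<times> {0..1}) \<subseteq> Y"
    "\<And>k p. k \<in> c ` A \<Longrightarrow> p \<in> A \<Longrightarrow> c p = k \<Longrightarrow> H k (p, 0) = fst p \<and> H k (p, 1) = snd p"
    by blast+
  define G where "G z = H (c (fst z)) z" for z
  have op: "openin (top_of_set A) {p \<in> A. c p = k}" for k
    by (rule openin_Collect_eventually) (use lc in blast)
  have "continuous_map (top_of_set (A \<times> {0..1})) euclidean G"
  proof (rule pasting_lemma[where I = "c ` A" and T = "\<lambda>k. {p \<in> A. c p = k} \<times> {0..1}" and f = H])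
    show "openin (top_of_set (A \<times> {0..1})) ({p \<in> A. c p = k} \<times> {0..1})" for k
      by (intro openin_Times op openin_subtopology_self)
    show "continuous_map (subtopology (top_of_set (A \<times> {0..1})) ({p \<in> A. c p = k} \<times> {0..1}))
        euclidean (H k)" if "k \<in> c ` A" for k
    proof -
      have "A \<times> {0..1} \<inter> {p \<in> A. c p = k} \<times> {0..1::real} = {p \<in> A. c p = k} \<times> {0..1}"
        by auto
      then show ?thesis
        using H(1)[OF that] by (simp add: subtopology_subtopology)
    qed
  qed (auto simp: G_def)
  moreover have "G ` (A \<times> {0..1}) \<subseteq> Y"
    using H(2) by (fastforce simp: G_def)
  ultimately show ?thesis
    unfolding motion_planner_on_def using H(3) by (intro exI[of _ G]) (auto simp: G_def)
qed

section \<open>Openness and path connectedness of the configuration space\<close>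

lemma open_orbit_conf:
  assumes "r \<ge> 1"
  shows "open (orbit_conf r :: (complex ^ 'n) set)"
proof -
  have "orbit_conf r = (\<Inter>i. {x :: complex ^ 'n. x $ i \<noteq> 0}) \<inter>
      (\<Inter>i. \<Inter>j\<in>- {i}. {x. (x $ i) ^ r \<noteq> (x $ j) ^ r})"
    by (auto simp: orbit_conf_iff_powers[OF assms])
  also have "open \<dots>"
    by (intro open_Int open_INT ballI finite open_Collect_neq continuous_intros)
  finally show ?thesis .
qed

lemma finite_root_affine:
  fixes a b :: "'a::field"
  assumes "a \<noteq> 0"
  shows "finite {z. a + z * b = 0}"
proof (rule finite_subset)
  show "{z. a + z * b = 0} \<subseteq> {- a / b}"
  proof safe
    fix z assume z: "a + z * b = 0"
    with assms have "b \<noteq> 0" by auto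
    moreover have "z * b = - a"
      using z by (simp add: eq_neg_iff_add_eq_0 add.commute)
    ultimately show "z = - a / b"
      using nonzero_eq_divide_eq by blast
  qed
qed simp

text \<open>The complex line through two points of the complement leaves it in finitely many points only.\<close>

lemma path_connected_orbit_conf: "path_connected (orbit_conf r :: (complex ^ 'n) set)"
  unfolding path_connected_component
proof safe
  fix x y :: "complex ^ 'n"
  assume x: "x \<in> orbit_conf r" and y: "y \<in> orbit_conf r"
  define \<zeta> where "\<zeta> = exp (2 * of_real pi * \<i> / of_nat r)"
  define l where "l z = (\<chi> i. x $ i + z * (y $ i - x $ i))" for z
  define N where "N = (\<Union>i. {z. x $ i + z * (y $ i - x $ i) = 0}) \<union>
      (\<Union>i. \<Union>j\<in>{j. i \<noteq> j}. \<Union>k\<in>{1..r}.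
        {z. (x $ j - \<zeta> ^ k * x $ i) + z * ((y $ j - x $ j) - \<zeta> ^ k * (y $ i - x $ i)) = 0})"
  \<comment> \<open>Each equation is affine in \<open>z\<close>, and its constant term, the value at
    \<open>x\<close>, is nonzero because \<open>x\<close> lies in the orbit configuration
    space.\<close>
  have "finite N"
    unfolding N_def using x
    by (intro finite_UnI finite_UN_I finite finite_atLeastAtMost finite_root_affine)
      (auto simp: orbit_conf_def \<zeta>_def)
  then have "path_connected (- N)"
    by (intro path_connected_complement_countable) (auto intro: countable_finite)
  moreover have "continuous_on (- N) l"
    unfolding l_def by (intro continuous_intros)
  ultimately have "path_connected (l ` (- N))"
    using path_connected_continuous_image by blast
  moreover have l_iff: "z \<in> N \<longleftrightarrow> l z \<notin> orbit_conf r" for z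
  proof -
    have "(x $ j - \<zeta> ^ k * x $ i) + z * ((y $ j - x $ j) - \<zeta> ^ k * (y $ i - x $ i)) =
        l z $ j - \<zeta> ^ k * l z $ i" for i j k
      by (simp add: l_def algebra_simps)
    moreover have "x $ i + z * (y $ i - x $ i) = l z $ i" for i
      by (simp add: l_def)
    ultimately show ?thesis
      unfolding N_def orbit_conf_def \<zeta>_def[symmetric] by (simp add: Bex_def)
  qed
  moreover have "l 0 = x" "l 1 = y"
    by (auto simp: l_def vec_eq_iff)
  ultimately show "path_component (orbit_conf r) x y"
    using x y
    by (metis ComplI image_eqI image_subsetI path_component_of_subset path_connected_component ComplD)
qed

subsection \<open>Cells of the orbit configuration space\<close>

definition direction :: "nat \<Rightarrow> complex ^ 'n \<Rightarrow> 'n \<Rightarrow> complex" where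
  "direction r x i = sgn ((x $ i) ^ r)"

definition level :: "nat \<Rightarrow> complex ^ 'n \<Rightarrow> nat" where
  "level r x = card (range (direction r x))"

text \<open>The cut of \<open>Arg2pi\<close> is the ray of \<open>o'\<close> itself. On a stratum no
  other direction can split off from that ray or merge into it, so the jump does no harm
  there.\<close>

definition angle :: "nat \<Rightarrow> 'n \<Rightarrow> complex ^ 'n \<Rightarrow> 'n \<Rightarrow> real" where
  "angle r o' x i = Arg2pi ((x $ i / x $ o') ^ r)"

definition log_radius :: "'n \<Rightarrow> complex ^ 'n \<Rightarrow> 'n \<Rightarrow> real" where
  "log_radius o' x i = ln (norm (x $ i / x $ o'))"

text \<open>The \<open>r\<close>-th root of unity that tells the \<open>r\<close>-th roots of \<open>(x\<^sub>i / x\<^sub>o)\<^sup>r\<close> apart.\<close>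

definition sheet :: "nat \<Rightarrow> 'n \<Rightarrow> complex ^ 'n \<Rightarrow> 'n \<Rightarrow> complex" where
  "sheet r o' x i = (x $ i / x $ o') /
     exp (of_real (log_radius o' x i) + \<i> * of_real (angle r o' x i / r))"

text \<open>The discrete invariants of a configuration. The orders are recorded as strict relations
  because convex combinations preserve strict inequalities.\<close>

definition cell :: "nat \<Rightarrow> 'n \<Rightarrow> complex ^ 'n \<Rightarrow>
    nat \<times> ('n \<times> 'n) set \<times> ('n \<times> 'n) set \<times> ('n \<Rightarrow> complex)" where
  "cell r o' x = (level r x, {(i, j). angle r o' x i < angle r o' x j},
     {(i, j). angle r o' x i = angle r o' x j \<and> log_radius o' x i < log_radius o' x j},
     sheet r o' x)"

lemma level_bounds: "1 \<le> level r (x :: complex ^ 'n)" "level r x \<le> CARD('n)"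
proof -
  show "level r x \<le> CARD('n)"
    unfolding level_def by (rule card_image_le) simp
  have "level r x \<noteq> 0"
    unfolding level_def by simp
  then show "1 \<le> level r x" by simp
qed

lemma angle_bounds: "0 \<le> angle r o' x i" "angle r o' x i < 2 * pi"
  unfolding angle_def by (auto simp: Arg2pi Arg2pi_ge_0 Arg2pi_lt_2pi)

lemma exp_Arg2pi:
  assumes "z \<noteq> 0"
  shows "exp (of_real (ln (norm z)) + \<i> * of_real (Arg2pi z)) = z"
  using assms Arg2pi_eq[of z] by (simp add: exp_add exp_of_real)

lemma Arg2pi_divide_eq_iff:
  assumes "a \<noteq> 0" "w \<noteq> 0" "z \<noteq> 0"
  shows "Arg2pi (w / a) = Arg2pi (z / a) \<longleftrightarrow> sgn w = sgn z"
proof -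
  have "Arg2pi (w / a) = Arg2pi (z / a) \<longleftrightarrow> (\<exists>c>0. w / a = of_real c * (z / a))"
    using assms by (intro Arg2pi_eq_iff) auto
  also have "\<dots> \<longleftrightarrow> (\<exists>c>0. w = of_real c * z)"
    using assms by simp
  also have "\<dots> \<longleftrightarrow> sgn w = sgn z"
  proof
    assume "\<exists>c>0. w = of_real c * z"
    then obtain c where "c > 0" "w = of_real c * z" by blast
    then show "sgn w = sgn z" by (simp add: sgn_mult sgn_of_real)
  next
    assume eq: "sgn w = sgn z"
    have "w = of_real (norm w) * sgn w"
      using assms by (simp add: sgn_eq)
    also have "\<dots> = of_real (norm w / norm z) * z"
      unfolding eq using assms by (simp add: sgn_eq)
    finally show "\<exists>c>0. w = of_real c * z"
      using assms by (intro exI[of _ "norm w / norm z"]) auto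
  qed
  finally show ?thesis .
qed

text \<open>\<open>g\<close> factors through \<open>f\<close> by a map of \<open>range f\<close>
  onto \<open>range g\<close>, which is injective when the cardinalities agree. Here
  \<open>f\<close> will be the directions of a nearby point and \<open>g\<close> those of the
  limit.\<close>

lemma card_range_coarsen:
  fixes f :: "'i::finite \<Rightarrow> 'a" and g :: "'i \<Rightarrow> 'b"
  assumes "\<And>i j. f i = f j \<Longrightarrow> g i = g j"
  shows "card (range g) \<le> card (range f)"
    and "card (range g) = card (range f) \<Longrightarrow> f i = f j \<longleftrightarrow> g i = g j"
proof -
  define h where "h v = g (inv f v)" for v
  have h: "h (f i) = g i" for i
    unfolding h_def using assms f_inv_into_f[of "f i" f UNIV] by blast
  then have range: "range g = h ` range f"
    by (auto simp: image_image)
  show "card (range g) \<le> card (range f)"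
    unfolding range by (rule card_image_le) simp
  assume "card (range g) = card (range f)"
  then have "inj_on h (range f)"
    unfolding range by (intro eq_card_imp_inj_on) auto
  then show "f i = f j \<longleftrightarrow> g i = g j"
    using h by (metis inj_on_contraD rangeI)
qed

context
  fixes r :: nat
  assumes r: "r \<ge> 1"
begin

lemma orbit_conf_nonzero: "x \<in> orbit_conf r \<Longrightarrow> x $ i \<noteq> 0"
  by (simp add: orbit_conf_iff_powers[OF r])

lemma orbit_conf_scale:
  assumes "x \<in> orbit_conf r" "c \<noteq> 0"
  shows "(\<chi> i. c * x $ i) \<in> orbit_conf r"
  using assms by (simp add: orbit_conf_iff_powers[OF r] power_mult_distrib)

lemma angle_eq_iff_direction_eq:
  assumes "x \<in> orbit_conf r"
  shows "angle r o' x i = angle r o' x j \<longleftrightarrow> direction r x i = direction r x j"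
  unfolding angle_def direction_def power_divide
  using assms by (intro Arg2pi_divide_eq_iff) (auto simp: orbit_conf_nonzero)

text \<open>The denominator in \<open>sheet\<close> is built from half of a polar form: its
  \<open>r\<close>-th power is the polar form of \<open>(x $ i / x $ o') ^ r\<close>. Hence
  \<open>sheet\<close> takes finitely many values.\<close>

lemma sheet_power:
  assumes "x \<in> orbit_conf r"
  shows "sheet r o' x i ^ r = 1"
proof -
  let ?u = "x $ i / x $ o'"
  have u: "?u \<noteq> 0"
    using assms by (simp add: orbit_conf_nonzero)
  define E where "E = exp (of_real (log_radius o' x i) + \<i> * of_real (angle r o' x i / r))"
  have "E ^ r = exp (of_real (ln (norm (?u ^ r))) + \<i> * of_real (Arg2pi (?u ^ r)))"
    using r u unfolding E_def
    by (simp add: exp_of_nat_mult[symmetric] log_radius_def angle_def norm_power ln_realpow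
        distrib_left del: power_divide)
  also have "\<dots> = ?u ^ r"
    using u by (intro exp_Arg2pi) simp
  finally have "(?u / E) ^ r = ?u ^ r / ?u ^ r"
    by (simp only: power_divide[of ?u E])
  also have "\<dots> = 1"
    using u by simp
  finally show ?thesis
    by (simp only: sheet_def E_def)
qed

text \<open>Equal angles and equal radii would give equal \<open>r\<close>-th powers.\<close>

lemma log_radius_neq:
  assumes x: "x \<in> orbit_conf r" and "i \<noteq> j" and eq: "angle r o' x i = angle r o' x j"
  shows "log_radius o' x i \<noteq> log_radius o' x j"
proof
  assume "log_radius o' x i = log_radius o' x j"
  then have "norm (x $ i / x $ o') = norm (x $ j / x $ o')"
    using x by (simp add: log_radius_def orbit_conf_nonzero)
  then have "norm ((x $ i / x $ o') ^ r) = norm ((x $ j / x $ o') ^ r)"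
    by (simp add: norm_power)
  then have "(x $ i / x $ o') ^ r = (x $ j / x $ o') ^ r"
    using eq Arg2pi_eq unfolding angle_def by metis
  then have "(x $ i) ^ r = (x $ j) ^ r"
    using x by (simp add: power_divide orbit_conf_nonzero)
  with x \<open>i \<noteq> j\<close> show False
    by (auto simp: orbit_conf_iff_powers[OF r])
qed

text \<open>In logarithmic coordinates a cell is convex.\<close>

lemma cell_convex:
  assumes x: "x \<in> orbit_conf r" and y: "y \<in> orbit_conf r" and xy: "cell r o' x = cell r o' y"
    and t: "0 \<le> t" "t \<le> 1"
  shows "(\<chi> i. sheet r o' y i * exp (of_real ((1 - t) * log_radius o' x i + t * log_radius o' y i) +
      \<i> * of_real (((1 - t) * angle r o' x i + t * angle r o' y i) / r))) \<in> orbit_conf r"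
proof -
  define \<rho> where "\<rho> i = (1 - t) * log_radius o' x i + t * log_radius o' y i" for i
  define \<alpha> where "\<alpha> i = (1 - t) * angle r o' x i + t * angle r o' y i" for i
  define z where "z i = sheet r o' y i * exp (of_real (\<rho> i) + \<i> * of_real (\<alpha> i / r))" for i
  have sheet: "sheet r o' y i \<noteq> 0" for i
    using sheet_power[OF y, of o' i] r by (auto simp: power_0_left)
  have mono: "(1 - t) * a + t * b < (1 - t) * a' + t * b'" if "a < a'" "b < b'" for a b a' b' :: real
    using that t by (cases "t = 0") (auto intro!: add_le_less_mono mult_left_mono)
  have \<alpha>: "0 \<le> \<alpha> i" "\<alpha> i < 2 * pi" for i
  proof -
    show "0 \<le> \<alpha> i"
      unfolding \<alpha>_def using t by (simp add: angle_bounds)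
    show "\<alpha> i < 2 * pi"
      using mono[OF angle_bounds(2)[of r o' x i] angle_bounds(2)[of r o' y i]]
      by (simp add: \<alpha>_def algebra_simps)
  qed
  have zr: "z i ^ r = exp (of_real (r * \<rho> i) + \<i> * of_real (\<alpha> i))" for i
    using r by (simp add: z_def power_mult_distrib sheet_power[OF y] exp_of_nat_mult[symmetric]
        distrib_left)
  have "z i ^ r \<noteq> z j ^ r" if "i \<noteq> j" for i j
  proof
    assume "z i ^ r = z j ^ r"
    then have eq: "exp (of_real (r * \<rho> i) + \<i> * of_real (\<alpha> i)) = exp (of_real (r * \<rho> j) + \<i> * of_real (\<alpha> j))"
      by (simp only: zr)
    \<comment> \<open>Both angles lie in \<open>[0, 2 pi)\<close>, where \<open>Arg2pi\<close>
      recovers them from the exponential.\<close>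
    have \<alpha>_eq: "\<alpha> i = \<alpha> j"
      using arg_cong[OF eq, of Arg2pi] \<alpha>[of i] \<alpha>[of j] by (simp add: Arg2pi_exp)
    have \<rho>_eq: "\<rho> i = \<rho> j"
      using arg_cong[OF eq, of norm] r by simp
    have lt: "angle r o' x k < angle r o' x l \<longleftrightarrow> angle r o' y k < angle r o' y l"
        "angle r o' x k = angle r o' x l \<and> log_radius o' x k < log_radius o' x l \<longleftrightarrow>
         angle r o' y k = angle r o' y l \<and> log_radius o' y k < log_radius o' y l" for k l
      using xy by (auto simp: cell_def set_eq_iff)
    have \<alpha>_less: "\<alpha> k < \<alpha> l" if "angle r o' x k < angle r o' x l" for k l
      unfolding \<alpha>_def using that lt(1)[of k l] by (intro mono) auto
    have \<rho>_less: "\<rho> k < \<rho> l"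
      if "angle r o' x k = angle r o' x l" "log_radius o' x k < log_radius o' x l" for k l
      unfolding \<rho>_def using that lt(2)[of k l] by (intro mono) auto
    have "angle r o' x i = angle r o' x j"
      using \<alpha>_less[of i j] \<alpha>_less[of j i] \<alpha>_eq by force
    moreover from this have "log_radius o' x i \<noteq> log_radius o' x j"
      using log_radius_neq[OF x \<open>i \<noteq> j\<close>] by blast
    ultimately show False
      using \<rho>_less[of i j] \<rho>_less[of j i] \<rho>_eq by force
  qed
  moreover have "z i \<noteq> 0" for i
    by (simp add: z_def sheet)
  ultimately have "(\<chi> i. z i) \<in> orbit_conf r"
    by (simp add: orbit_conf_iff_powers[OF r])
  then show ?thesis
    by (simp add: z_def \<alpha>_def \<rho>_def)
qed

lemma sheet_decomposition:
  "x $ i / x $ o' =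
    sheet r o' x i * exp (of_real (log_radius o' x i) + \<i> * of_real (angle r o' x i / r))"
  by (simp add: sheet_def)

section \<open>Directions, angles and cells under limits\<close>

lemma eventually_direction_eq_imp:
  assumes X: "(X \<longlongrightarrow> x) F" and x: "x \<in> orbit_conf r"
  shows "\<forall>\<^sub>F q in F. \<forall>i j. direction r (X q) i = direction r (X q) j \<longrightarrow>
    direction r x i = direction r x j"
proof (intro eventually_all_finite)
  fix i j
  show "\<forall>\<^sub>F q in F. direction r (X q) i = direction r (X q) j \<longrightarrow>
    direction r x i = direction r x j"
  proof (cases "direction r x i = direction r x j")
    case False
    \<comment> \<open>Directions vary continuously, so distinct ones stay distinct nearby and only
      coincidences can break up.\<close>
    have "((\<lambda>q. direction r (X q) k) \<longlongrightarrow> direction r x k) F" for k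
      unfolding direction_def using x
      by (intro tendsto_intros X) (simp add: orbit_conf_nonzero)
    then have "((\<lambda>q. direction r (X q) i - direction r (X q) j) \<longlongrightarrow>
        direction r x i - direction r x j) F"
      by (intro tendsto_intros)
    from tendsto_imp_eventually_ne[OF this, of 0] False show ?thesis
      by (auto elim: eventually_mono)
  qed simp
qed

lemma eventually_level_ge:
  assumes "(X \<longlongrightarrow> x) F" "x \<in> orbit_conf r"
  shows "\<forall>\<^sub>F q in F. level r x \<le> level r (X q)"
  using eventually_direction_eq_imp[OF assms]
  by (rule eventually_mono) (unfold level_def, rule card_range_coarsen(1), blast)

text \<open>If the number of directions does not grow, no coincidence breaks up.\<close>

lemma eventually_direction_eq_iff:
  assumes "(X \<longlongrightarrow> x) F" "x \<in> orbit_conf r" "\<forall>\<^sub>F q in F. level r (X q) = level r x"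
  shows "\<forall>\<^sub>F q in F. \<forall>i j. direction r (X q) i = direction r (X q) j \<longleftrightarrow>
    direction r x i = direction r x j"
  using eventually_direction_eq_imp[OF assms(1,2)] assms(3)
proof eventually_elim
  case (elim q)
  then show ?case
    using card_range_coarsen(2)[of "direction r (X q)" "direction r x"]
    unfolding level_def by metis
qed

text \<open>\<open>Arg2pi\<close> jumps only at the ray of \<open>o'\<close>. With the level fixed,
  a point on that ray stays on it and its angle is constantly 0; any other point stays off the
  cut.\<close>

lemma tendsto_angle:
  assumes X: "(X \<longlongrightarrow> x) F" and x: "x \<in> orbit_conf r"
    and Y: "\<forall>\<^sub>F q in F. X q \<in> orbit_conf r" and lev: "\<forall>\<^sub>F q in F. level r (X q) = level r x"
  shows "((\<lambda>q. angle r o' (X q) i) \<longlongrightarrow> angle r o' x i) F"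
proof -
  have o': "angle r o' y o' = 0" if "y \<in> orbit_conf r" for y
    using that by (simp add: angle_def orbit_conf_nonzero Arg2pi_eq_0)
  show ?thesis
  proof (cases "direction r x i = direction r x o'")
    case True
    have "\<forall>\<^sub>F q in F. angle r o' (X q) i = 0"
      using eventually_direction_eq_iff[OF X x lev] Y
    proof eventually_elim
      case (elim q)
      then show ?case
        using True angle_eq_iff_direction_eq[of "X q" o' i o'] o' by auto
    qed
    moreover have "angle r o' x i = 0"
      using True angle_eq_iff_direction_eq[OF x, of o' i o'] o'[OF x] by simp
    ultimately show ?thesis
      by (simp add: tendsto_eventually)
  next
    case False
    have "angle r o' x i \<noteq> 0"
      using False angle_eq_iff_direction_eq[OF x, of o' i o'] o'[OF x] by simp
    then have "(x $ i / x $ o') ^ r \<notin> \<real>\<^sub>\<ge>\<^sub>0"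
      unfolding angle_def by (auto simp: Arg2pi_eq_0 complex_nonneg_Reals_iff complex_is_Real_iff)
    then have "isCont Arg2pi ((x $ i / x $ o') ^ r)"
      by (rule continuous_at_Arg2pi)
    then show ?thesis
      unfolding angle_def
      by (rule isCont_tendsto_compose) (intro tendsto_intros X, simp add: orbit_conf_nonzero x)
  qed
qed

lemma tendsto_log_radius:
  assumes "(X \<longlongrightarrow> x) F" "x \<in> orbit_conf r"
  shows "((\<lambda>q. log_radius o' (X q) i) \<longlongrightarrow> log_radius o' x i) F"
  unfolding log_radius_def using assms
  by (intro tendsto_intros) (auto simp: orbit_conf_nonzero)

text \<open>Strict inequalities persist by continuity, equal angles by constancy of the level, and
  sheets because the roots of unity form a discrete set.\<close>

lemma eventually_cell_eq:
  assumes X: "(X \<longlongrightarrow> x) F" and x: "x \<in> orbit_conf r"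
    and Y: "\<forall>\<^sub>F q in F. X q \<in> orbit_conf r" and lev: "\<forall>\<^sub>F q in F. level r (X q) = level r x"
  shows "\<forall>\<^sub>F q in F. cell r o' (X q) = cell r o' x"
proof -
  note angle = tendsto_angle[OF X x Y lev, of o']
  note radius = tendsto_log_radius[OF X x, of o']
  have eq: "\<forall>\<^sub>F q in F. \<forall>i j. angle r o' (X q) i = angle r o' (X q) j \<longleftrightarrow>
      angle r o' x i = angle r o' x j"
    using eventually_direction_eq_iff[OF X x lev] Y
  proof eventually_elim
    case (elim q)
    then show ?case
      using angle_eq_iff_direction_eq[OF x] angle_eq_iff_direction_eq[OF elim(2)] by blast
  qed
  have less_imp: "\<forall>\<^sub>F q in F. f q < g q" if "(f \<longlongrightarrow> a) F" "(g \<longlongrightarrow> b) F" "a < b"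
    for f g :: "_ \<Rightarrow> real" and a b
    using order_tendstoD(2)[OF tendsto_diff[OF that(1,2)], of 0] that(3) by simp
  have less: "\<forall>\<^sub>F q in F. \<forall>i j. angle r o' (X q) i < angle r o' (X q) j \<longleftrightarrow>
      angle r o' x i < angle r o' x j"
  proof (intro eventually_all_finite)
    fix i j
    consider "angle r o' x i < angle r o' x j" | "angle r o' x i = angle r o' x j"
      | "angle r o' x j < angle r o' x i" by linarith
    then show "\<forall>\<^sub>F q in F. angle r o' (X q) i < angle r o' (X q) j \<longleftrightarrow> angle r o' x i < angle r o' x j"
    proof cases
      case 1
      from less_imp[OF angle angle this] 1 show ?thesis by (auto elim: eventually_mono)
    next
      case 2
      show ?thesis
        using eq
      proof eventually_elim
        case (elim q)
        then have "angle r o' (X q) i = angle r o' (X q) j"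
          using 2 by blast
        then show ?case using 2 by simp
      qed
    next
      case 3
      from less_imp[OF angle angle this] 3 show ?thesis by (auto elim: eventually_mono)
    qed
  qed
  have radius_less: "\<forall>\<^sub>F q in F. \<forall>i j.
      (angle r o' (X q) i = angle r o' (X q) j \<and> log_radius o' (X q) i < log_radius o' (X q) j) \<longleftrightarrow>
      (angle r o' x i = angle r o' x j \<and> log_radius o' x i < log_radius o' x j)"
  proof (intro eventually_all_finite)
    fix i j
    consider "angle r o' x i \<noteq> angle r o' x j \<or> i = j"
      | "angle r o' x i = angle r o' x j" "log_radius o' x i < log_radius o' x j"
      | "angle r o' x i = angle r o' x j" "log_radius o' x j < log_radius o' x i"
      using log_radius_neq[OF x, of i j o'] by (metis linorder_neqE)
    then show "\<forall>\<^sub>F q in F.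
      (angle r o' (X q) i = angle r o' (X q) j \<and> log_radius o' (X q) i < log_radius o' (X q) j) \<longleftrightarrow>
      (angle r o' x i = angle r o' x j \<and> log_radius o' x i < log_radius o' x j)"
    proof cases
      case 1
      with eq show ?thesis by (auto elim!: eventually_mono)
    next
      case 2
      show ?thesis
        using eq less_imp[OF radius radius 2(2)] by eventually_elim (use 2 in auto)
    next
      case 3
      show ?thesis
        using eq less_imp[OF radius radius 3(2)] by eventually_elim (use 3 in auto)
    qed
  qed
  have sheet: "\<forall>\<^sub>F q in F. \<forall>i. sheet r o' (X q) i = sheet r o' x i"
  proof (intro eventually_all_finite)
    fix i
    have "((\<lambda>q. sheet r o' (X q) i) \<longlongrightarrow> sheet r o' x i) F"
      unfolding sheet_def using x r
      by (intro tendsto_intros X angle radius) (auto simp: orbit_conf_nonzero)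
    \<comment> \<open>This neighbourhood of the limit sheet omits all other roots of unity.\<close>
    moreover have "open (- ({z. z ^ r = 1} - {sheet r o' x i}))"
      using r by (intro open_Compl finite_imp_closed finite_Diff finite_roots_unity)
    ultimately have "\<forall>\<^sub>F q in F. sheet r o' (X q) i \<in> - ({z. z ^ r = 1} - {sheet r o' x i})"
      by (rule topological_tendstoD) simp
    with Y show "\<forall>\<^sub>F q in F. sheet r o' (X q) i = sheet r o' x i"
      by eventually_elim (simp add: sheet_power)
  qed
  show ?thesis
    using lev less radius_less sheet
    by eventually_elim (simp add: cell_def fun_eq_iff)
qed

text \<open>The straight line in logarithmic coordinates stays in the cell's convex chart;
  multiplying by \<open>f q $ o'\<close> throughout leaves the coordinate \<open>o'\<close> where it
  was.\<close>

lemma homotopic_to_cell_centre: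
  fixes f :: "'b::topological_space \<Rightarrow> complex ^ 'n"
  assumes f: "continuous_on D f" "f ` D \<subseteq> orbit_conf r" and x: "x \<in> orbit_conf r"
    and cell: "\<And>q. q \<in> D \<Longrightarrow> cell r o' (f q) = cell r o' x"
  shows "homotopic_with_canon (\<lambda>_. True) D (orbit_conf r) f (\<lambda>q. \<chi> i. f q $ o' * (x $ i / x $ o'))"
proof (rule homotopic_with_canonI[where h = "\<lambda>(t, q). \<chi> i. f q $ o' * (sheet r o' x i *
      exp (of_real ((1 - t) * log_radius o' (f q) i + t * log_radius o' x i) +
        \<i> * of_real (((1 - t) * angle r o' (f q) i + t * angle r o' x i) / r)))"])
  have lim: "(f \<longlongrightarrow> f q) (at q within D)" if "q \<in> D" for q
    using f(1) that by (simp add: continuous_on_def)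
  have ev: "\<forall>\<^sub>F p in at q within D. f p \<in> orbit_conf r"
      "\<forall>\<^sub>F p in at q within D. level r (f p) = level r (f q)" if "q \<in> D" for q
    using f(2) cell that by (auto simp: eventually_at_topological cell_def intro!: exI[of _ UNIV])
  have angle: "continuous_on D (\<lambda>q. angle r o' (f q) i)" for i
    unfolding continuous_on_def using f(2) by (auto intro!: tendsto_angle lim ev)
  have radius: "continuous_on D (\<lambda>q. log_radius o' (f q) i)" for i
    unfolding continuous_on_def using f(2) by (auto intro!: tendsto_log_radius lim)
  have snd: "continuous_on ({0..1::real} \<times> D) (\<lambda>z. g (snd z))" if "continuous_on D g"
    for g :: "'b \<Rightarrow> 'c::topological_space"
    by (rule continuous_on_compose2[OF that]) (auto intro!: continuous_intros)
  show "continuous_on ({0..1} \<times> D) (\<lambda>(t, q). \<chi> i. f q $ o' * (sheet r o' x i *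
      exp (of_real ((1 - t) * log_radius o' (f q) i + t * log_radius o' x i) +
        \<i> * of_real (((1 - t) * angle r o' (f q) i + t * angle r o' x i) / r))))"
    unfolding case_prod_beta using r
    by (intro continuous_intros snd[OF angle] snd[OF radius] snd[OF f(1)]) auto
  fix q assume q: "q \<in> D"
  then have fq: "f q \<in> orbit_conf r" using f(2) by blast
  have sheet: "sheet r o' (f q) = sheet r o' x"
    using cell[OF q] by (simp add: cell_def)
  show "(case (0, q) of (t, q) \<Rightarrow> \<chi> i. f q $ o' * (sheet r o' x i *
      exp (of_real ((1 - t) * log_radius o' (f q) i + t * log_radius o' x i) +
        \<i> * of_real (((1 - t) * angle r o' (f q) i + t * angle r o' x i) / r)))) = f q"
  proof -
    have "f q $ o' * (sheet r o' x i * exp (of_real (log_radius o' (f q) i) +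
        \<i> * of_real (angle r o' (f q) i / r))) = f q $ i" for i
      unfolding sheet[symmetric] sheet_decomposition[symmetric]
      using orbit_conf_nonzero[OF fq, of o'] by simp
    then show ?thesis
      by (simp add: vec_eq_iff)
  qed
  show "(case (1, q) of (t, q) \<Rightarrow> \<chi> i. f q $ o' * (sheet r o' x i *
      exp (of_real ((1 - t) * log_radius o' (f q) i + t * log_radius o' x i) +
        \<i> * of_real (((1 - t) * angle r o' (f q) i + t * angle r o' x i) / r)))) =
      (\<chi> i. f q $ o' * (x $ i / x $ o'))"
    unfolding sheet_decomposition[of x _ o'] by simp
  show "(case (t, q) of (t, q) \<Rightarrow> \<chi> i. f q $ o' * (sheet r o' x i *
      exp (of_real ((1 - t) * log_radius o' (f q) i + t * log_radius o' x i) +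
        \<i> * of_real (((1 - t) * angle r o' (f q) i + t * angle r o' x i) / r)))) \<in> orbit_conf r"
    if "0 \<le> t" "t \<le> 1" for t :: real
    using orbit_conf_scale[OF cell_convex[OF fq x cell[OF q] that] orbit_conf_nonzero[OF fq, of o']]
    by simp
qed

end

subsection \<open>The upper bound\<close>

text \<open>The principal logarithm jumps across the negative axis, but on the axis itself it is
  \<open>Ln (- w) + \<i> * pi\<close>, again continuous.\<close>

lemma continuous_on_Ln_nonpos_dichotomy:
  fixes w :: "'b::topological_space \<Rightarrow> complex"
  assumes w: "continuous_on D w" "\<And>q. q \<in> D \<Longrightarrow> w q \<noteq> 0"
    and dich: "(\<forall>q\<in>D. w q \<in> \<real>\<^sub>\<le>\<^sub>0) \<or> (\<forall>q\<in>D. w q \<notin> \<real>\<^sub>\<le>\<^sub>0)"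
  shows "continuous_on D (\<lambda>q. Ln (w q))"
  using dich
proof
  assume neg: "\<forall>q\<in>D. w q \<in> \<real>\<^sub>\<le>\<^sub>0"
  have w_neg: "Re (w q) < 0" "Im (w q) = 0" if "q \<in> D" for q
    using neg w(2) that by (auto simp: complex_nonpos_Reals_iff complex_eq_iff order_less_le)
  have "continuous_on D (\<lambda>q. Ln (- w q) + \<i> * pi)"
    using w_neg by (intro continuous_intros w) (force simp: complex_nonpos_Reals_iff)
  then show ?thesis
  proof (rule continuous_on_eq)
    show "Ln (- w q) + \<i> * pi = Ln (w q)" if "q \<in> D" for q
      using Ln_minus[of "- w q"] w_neg[OF that] w(2)[OF that] by simp
  qed
qed (use w in \<open>auto intro!: continuous_intros\<close>)

text \<open>Four motions are concatenated: contract the first configuration to the shape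
  \<open>u\<close>, carry its coordinate \<open>o'\<close> to that of the second, change the shape
  from \<open>u\<close> to \<open>v\<close>, and undo the contraction of the second.\<close>

lemma motion_planner_on_cell_product:
  fixes D :: "((complex ^ 'n) \<times> (complex ^ 'n)) set"
  assumes r: "r \<ge> 1" and D: "D \<subseteq> orbit_conf r \<times> orbit_conf r" and "(x, y) \<in> D"
    and cell: "\<And>q. q \<in> D \<Longrightarrow> cell r o' (fst q) = cell r o' x"
      "\<And>q. q \<in> D \<Longrightarrow> cell r o' (snd q) = cell r o' y"
    and dich: "(\<forall>q\<in>D. snd q $ o' / fst q $ o' \<in> \<real>\<^sub>\<le>\<^sub>0) \<or> (\<forall>q\<in>D. snd q $ o' / fst q $ o' \<notin> \<real>\<^sub>\<le>\<^sub>0)"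
  shows "motion_planner_on (orbit_conf r) D"
proof -
  let ?Y = "orbit_conf r :: (complex ^ 'n) set"
  note [trans] = homotopic_with_trans
  let ?hom = "homotopic_with_canon (\<lambda>_. True) D ?Y"
  have x: "x \<in> ?Y" and y: "y \<in> ?Y"
    using assms(2,3) by auto
  \<comment> \<open>The shapes of the two centres, scaled to have coordinate 1 at
    \<open>o'\<close>.\<close>
  define u where "u = (\<chi> i. (1 / x $ o') * x $ i)"
  define v where "v = (\<chi> i. (1 / y $ o') * y $ i)"
  have uv: "u \<in> ?Y" "v \<in> ?Y"
    unfolding u_def v_def by (intro orbit_conf_scale[OF r] x y; simp add: orbit_conf_nonzero[OF r] x y)+
  have nz: "a $ o' \<noteq> 0" "b $ o' \<noteq> 0" if "(a, b) \<in> D" for a b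
    using D that by (auto simp: orbit_conf_nonzero[OF r])
  have snd: "continuous_on ({0..1::real} \<times> D) (\<lambda>z. g (snd z))" if "continuous_on D g"
    for g :: "_ \<Rightarrow> complex"
    by (rule continuous_on_compose2[OF that]) (auto intro!: continuous_intros)
  have sub: "fst ` D \<subseteq> ?Y" "snd ` D \<subseteq> ?Y"
    using D by auto
  have "?hom fst (\<lambda>q. \<chi> i. fst q $ o' * u $ i)"
    using homotopic_to_cell_centre[OF r continuous_on_fst[OF continuous_on_id] sub(1) x cell(1)]
    by (simp add: u_def)
  also have "?hom (\<lambda>q. \<chi> i. fst q $ o' * u $ i) (\<lambda>q. \<chi> i. snd q $ o' * u $ i)"
  proof (rule homotopic_with_canonI[where h = "\<lambda>z. \<chi> i.
        (fst (snd z) $ o' * exp (of_real (fst z) * Ln (snd (snd z) $ o' / fst (snd z) $ o'))) * u $ i"])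
    have "continuous_on D (\<lambda>q. Ln (snd q $ o' / fst q $ o'))"
      by (rule continuous_on_Ln_nonpos_dichotomy[OF _ _ dich]) (auto intro!: continuous_intros simp: nz)
    note Ln = snd[OF this]
    show "continuous_on ({0..1} \<times> D) (\<lambda>z. \<chi> i.
        (fst (snd z) $ o' * exp (of_real (fst z) * Ln (snd (snd z) $ o' / fst (snd z) $ o'))) * u $ i)"
      by (rule continuous_on_vec_lambda, rule continuous_on_mult_right, rule continuous_on_mult)
        (intro continuous_intros continuous_on_exp continuous_on_mult[OF _ Ln])+
  qed (use nz uv in \<open>auto intro!: orbit_conf_scale[OF r] simp: vec_eq_iff\<close>)
  also have "?hom (\<lambda>q. \<chi> i. snd q $ o' * u $ i) (\<lambda>q. \<chi> i. snd q $ o' * v $ i)"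
  proof -
    \<comment> \<open>The shapes do not depend on \<open>q\<close>, so one path serves all of
      \<open>D\<close>.\<close>
    obtain g where g: "path g" "path_image g \<subseteq> ?Y" "pathstart g = u" "pathfinish g = v"
      using path_connected_orbit_conf[of r] uv unfolding path_connected_def by metis
    have "continuous_on ({0..1} \<times> D) (\<lambda>z. g (fst z))"
      by (rule continuous_on_compose2[OF g(1)[unfolded path_def]]) (auto intro!: continuous_intros)
    then have "continuous_on ({0..1} \<times> D) (\<lambda>z. \<chi> i. snd (snd z) $ o' * g (fst z) $ i)"
      by (intro continuous_intros)
    then show ?thesis
      by (rule homotopic_with_canonI)
        (use g nz in \<open>auto intro!: orbit_conf_scale[OF r] simp: path_image_def pathstart_def pathfinish_def\<close>)
  qed
  also have "?hom (\<lambda>q. \<chi> i. snd q $ o' * v $ i) snd"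
    using homotopic_to_cell_centre[OF r continuous_on_snd[OF continuous_on_id] sub(2) y cell(2)]
    by (subst homotopic_with_sym) (simp add: v_def)
  finally show ?thesis
    unfolding motion_planner_on_iff_homotopic .
qed

lemma orbit_conf_mp_cover_upper_bound:
  assumes r: "r \<ge> 1"
  shows "has_mp_cover (orbit_conf r :: (complex ^ 'n) set) (2 * CARD('n))"
proof -
  let ?Y = "orbit_conf r :: (complex ^ 'n) set"
  fix o' :: 'n
  define neg where "neg q \<longleftrightarrow> snd q $ o' / fst q $ o' \<in> \<real>\<^sub>\<le>\<^sub>0" for q :: "(complex ^ 'n) \<times> (complex ^ 'n)"
  \<comment> \<open>\<open>neg\<close> is a closed condition and therefore adds 0, its complement 1.
    Levels start at 1, so \<open>s\<close> has the values 0 to \<open>2 (n - 1) + 1\<close> at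
    most.\<close>
  define s where "s q = (level r (fst q) - 1) + (level r (snd q) - 1) + (if neg q then 0 else 1)" for q
  have ev: "\<forall>\<^sub>F p in at q within S. level r (fst q) \<le> level r (fst p)"
    "\<forall>\<^sub>F p in at q within S. level r (snd q) \<le> level r (snd p)"
    "\<forall>\<^sub>F p in at q within S. neg p \<longrightarrow> neg q"
    if q: "q \<in> ?Y \<times> ?Y" for q S
  proof -
    show "\<forall>\<^sub>F p in at q within S. level r (fst q) \<le> level r (fst p)"
      "\<forall>\<^sub>F p in at q within S. level r (snd q) \<le> level r (snd p)"
      using q by (auto intro!: eventually_level_ge[OF r] tendsto_intros)
    show "\<forall>\<^sub>F p in at q within S. neg p \<longrightarrow> neg q"
    proof (cases "neg q")
      case False
      have "((\<lambda>p. snd p $ o' / fst p $ o') \<longlongrightarrow> snd q $ o' / fst q $ o') (at q within S)"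
        using q by (intro tendsto_intros) (auto simp: orbit_conf_nonzero[OF r])
      moreover have "open (- \<real>\<^sub>\<le>\<^sub>0 :: complex set)"
        by (simp add: open_Compl)
      ultimately have "\<forall>\<^sub>F p in at q within S. snd p $ o' / fst p $ o' \<in> - \<real>\<^sub>\<le>\<^sub>0"
        using False by (intro topological_tendstoD) (auto simp: neg_def)
      then show ?thesis
        by (rule eventually_mono) (simp add: neg_def)
    qed simp
  qed
  show ?thesis
  proof (rule has_mp_cover_stratified[OF open_orbit_conf[OF r], of s])
    show "s q < 2 * CARD('n)" for q
      using level_bounds[of r "fst q"] level_bounds[of r "snd q"]
      unfolding s_def by (cases "neg q"; simp; arith)
    show "\<forall>\<^sub>F p in at q within ?Y \<times> ?Y. s q \<le> s p" if "q \<in> ?Y \<times> ?Y" for q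
      using ev[OF that, of "?Y \<times> ?Y"]
      by eventually_elim (auto simp: s_def intro: add_mono)
    fix k
    define A where "A = {q \<in> ?Y \<times> ?Y. s q = k}"
    define c where "c q = (cell r o' (fst q), cell r o' (snd q), neg q)" for q
    have "motion_planner_on ?Y A"
    proof (rule motion_planner_on_locally_constant[where c = c])
      fix q assume q: "q \<in> A"
      then have qY: "q \<in> ?Y \<times> ?Y" by (simp add: A_def)
      have inA: "\<forall>\<^sub>F p in at q within A. p \<in> A"
        by (simp add: eventually_at_filter)
      \<comment> \<open>None of the three summands can drop near \<open>q\<close>; as their sum is
        constant on \<open>A\<close>, each of them is locally constant.\<close>
      have lev: "\<forall>\<^sub>F p in at q within A. level r (fst p) = level r (fst q) \<and>
          level r (snd p) = level r (snd q) \<and> (neg p \<longleftrightarrow> neg q)"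
        using ev[OF qY, of A] inA
      proof eventually_elim
        case (elim p)
        have "s p = s q"
          using elim(4) q by (simp add: A_def)
        then show ?case
          using elim(1,2,3) level_bounds(1)[of r "fst q"] level_bounds(1)[of r "snd q"]
          by (auto simp: s_def split: if_splits)
      qed
      have "\<forall>\<^sub>F p in at q within A. cell r o' (fst p) = cell r o' (fst q)"
      proof (rule eventually_cell_eq[OF r])
        show "\<forall>\<^sub>F p in at q within A. fst p \<in> ?Y"
          using inA by (rule eventually_mono) (auto simp: A_def)
        show "\<forall>\<^sub>F p in at q within A. level r (fst p) = level r (fst q)"
          using lev by (rule eventually_mono) simp
      qed (use qY in \<open>auto intro!: tendsto_intros\<close>)
      moreover have "\<forall>\<^sub>F p in at q within A. cell r o' (snd p) = cell r o' (snd q)"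
      proof (rule eventually_cell_eq[OF r])
        show "\<forall>\<^sub>F p in at q within A. snd p \<in> ?Y"
          using inA by (rule eventually_mono) (auto simp: A_def)
        show "\<forall>\<^sub>F p in at q within A. level r (snd p) = level r (snd q)"
          using lev by (rule eventually_mono) simp
      qed (use qY in \<open>auto intro!: tendsto_intros\<close>)
      ultimately show "\<forall>\<^sub>F p in at q within A. c p = c q"
        using lev by eventually_elim (simp add: c_def)
      show "motion_planner_on ?Y {p \<in> A. c p = c q}"
        \<comment> \<open>The two components of \<open>q\<close> serve as centres of their
          cells.\<close>
        by (rule motion_planner_on_cell_product[OF r, of _ "fst q" "snd q" o'])
          (use q in \<open>auto simp: A_def c_def neg_def\<close>)
    qed
    then show "motion_planner_on ?Y {q \<in> ?Y \<times> ?Y. s q = k}"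
      by (simp add: A_def)
  qed
qed

theorem theorem5p3:
  fixes r :: nat
  assumes "r \<ge> 1"
  shows "TC (orbit_conf r :: (complex ^ 'n) set) = enat (2 * CARD('n))"
  unfolding TC_def
proof (rule antisym)
  show "Inf {enat m | m. has_mp_cover (orbit_conf r :: (complex ^ 'n) set) m} \<le> enat (2 * CARD('n))"
    using orbit_conf_mp_cover_upper_bound[OF assms] by (blast intro: Inf_lower)
  show "enat (2 * CARD('n)) \<le> Inf {enat m | m. has_mp_cover (orbit_conf r :: (complex ^ 'n) set) m}"
    using orbit_conf_mp_cover_lower_bound[OF assms] by (auto intro!: Inf_greatest)
qed

end
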